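(* In a McVittie spacetime with $K<0$ (normalised to $K=-1$), the energy density $\mu$ and pressure $P$ are finite at all points of $\{(t,r):t\in I,\ r\ge r_1(t)\}$, where $I$ is the maximal interval on which the energy density and pressure of the FLRW background are finite (values on $r=r_1(t)$ being understood as limits $r\to r_1(t)^+$).
   Context: $M>0$ and $\Lambda\in\mathbb{R}$ are constants, $K=-1$, $a$ is the ($C^2$, positive) scale factor and $H=a'/a$. $\kappa(t,r)=1-\frac{2M}{r}+\frac{r^2}{a^2(t)}$; $r_1(t)$ is the unique positive zero of $r\mapsto\kappa(t,r)$. The McVittie spacetime has the metric $$ds^2=-\sigma^2(H^{-2}-r^2\kappa^{-1})dt^2-2\sigma r\kappa^{-1}dt\,dr+\kappa^{-1}dr^2+r^2d\omega^2,\qquad \sigma=\frac{H}{a^2}\kappa^{1/2}\int_r^\infty\bar r\,\kappa^{-3/2}(t,\bar r)\,d\bar r$$ on $\{r>r_1(t)\}\times\mathbb{S}^2$, with energy density and pressure $$8\pi\mu+\Lambda=3(H^2+Ka^{-2}),\qquad 8\pi P-\Lambda=-2\frac{H}{\sigma}(H'-Ka^{-2})-3(H^2+Ka^{-2}),$$ where $H/\sigma$ is the reciprocal of $\sigma/H=a^{-2}\kappa^{1/2}\int_r^\infty\bar r\kappa^{-3/2}d\bar r$. The density and pressure of the FLRW background are given by $8\pi\mu_{FLRW}+\Lambda=3(H^2+Ka^{-2})$ and $8\pi P_{FLRW}-\Lambda=-2H'-3H^2-Ka^{-2}$. *)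

theory Defs
  imports "HOL-Analysis.Analysis"
begin

text \<open>
  Densities and pressures are extended reals: they take the value \<open>\<infinity>\<close> wherever one of the
  ingredients of the defining formula (a derivative, a quotient, an improper integral) does not
  exist.  Without this, the totality of HOL functions would make every finiteness claim trivial.
\<close>

abbreviation curv :: real where "curv \<equiv> -1"

definition hubble :: "(real \<Rightarrow> real) \<Rightarrow> real \<Rightarrow> real" where
  "hubble a t = deriv a t / a t"

text \<open>Only meaningful on an open set, since \<open>deriv\<close> is the two-sided derivative.\<close>

definition C2_on :: "(real \<Rightarrow> real) \<Rightarrow> real set \<Rightarrow> bool" where
  "C2_on a T \<longleftrightarrow> a C1_differentiable_on T \<and> deriv a C1_differentiable_on T"

definition hubble_exists :: "(real \<Rightarrow> real) \<Rightarrow> real \<Rightarrow> bool" where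
  "hubble_exists a t \<longleftrightarrow> a t \<noteq> 0 \<and> a field_differentiable at t"

definition flrw_density :: "real \<Rightarrow> (real \<Rightarrow> real) \<Rightarrow> real \<Rightarrow> ereal" where
  "flrw_density \<Lambda> a t =
     (if hubble_exists a t
      then ereal ((3 * ((hubble a t)\<^sup>2 + curv / (a t)\<^sup>2) - \<Lambda>) / (8 * pi))
      else \<infinity>)"

definition flrw_pressure :: "real \<Rightarrow> (real \<Rightarrow> real) \<Rightarrow> real \<Rightarrow> ereal" where
  "flrw_pressure \<Lambda> a t =
     (if hubble_exists a t \<and> hubble a field_differentiable at t
      then ereal ((- 2 * deriv (hubble a) t - 3 * (hubble a t)\<^sup>2 - curv / (a t)\<^sup>2 + \<Lambda>) / (8 * pi))
      else \<infinity>)"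

definition flrw_finite_on :: "real \<Rightarrow> (real \<Rightarrow> real) \<Rightarrow> real set \<Rightarrow> bool" where
  "flrw_finite_on \<Lambda> a J \<longleftrightarrow>
     (\<forall>t\<in>J. \<bar>flrw_density \<Lambda> a t\<bar> \<noteq> \<infinity> \<and> \<bar>flrw_pressure \<Lambda> a t\<bar> \<noteq> \<infinity>)"

text \<open>\<open>T\<close> is the time domain of the scale factor \<open>a\<close>; values of \<open>a\<close> outside \<open>T\<close> carry no meaning.\<close>

definition maximal_flrw_interval ::
    "real \<Rightarrow> (real \<Rightarrow> real) \<Rightarrow> real set \<Rightarrow> real set \<Rightarrow> bool" where
  "maximal_flrw_interval \<Lambda> a T I \<longleftrightarrow>
     is_interval I \<and> I \<subseteq> T \<and> flrw_finite_on \<Lambda> a I \<and>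
     (\<forall>J. is_interval J \<and> I \<subseteq> J \<and> J \<subseteq> T \<and> flrw_finite_on \<Lambda> a J \<longrightarrow> J = I)"

definition kappa :: "real \<Rightarrow> (real \<Rightarrow> real) \<Rightarrow> real \<Rightarrow> real \<Rightarrow> real" where
  "kappa M a t r = 1 - 2 * M / r + r\<^sup>2 / (a t)\<^sup>2"

definition r1 :: "real \<Rightarrow> (real \<Rightarrow> real) \<Rightarrow> real \<Rightarrow> real" where
  "r1 M a t = (THE r. 0 < r \<and> kappa M a t r = 0)"

definition sigma_integrand :: "real \<Rightarrow> (real \<Rightarrow> real) \<Rightarrow> real \<Rightarrow> real \<Rightarrow> real" where
  "sigma_integrand M a t x = x * kappa M a t x powr (-3/2)"

text \<open>
  The quotient \<open>\<sigma>/H\<close>, which makes sense also at times where \<open>H = 0\<close>.  The integrand is positive for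
  \<open>r > r\<^sub>1(t)\<close>, so the improper integral over \<open>(r, \<infinity>)\<close> is the Lebesgue integral.
\<close>

definition sigma_over_H :: "real \<Rightarrow> (real \<Rightarrow> real) \<Rightarrow> real \<Rightarrow> real \<Rightarrow> real" where
  "sigma_over_H M a t r =
     sqrt (kappa M a t r) / (a t)\<^sup>2 * (LBINT x:{r<..}. sigma_integrand M a t x)"

definition mcvittie_density ::
    "real \<Rightarrow> real \<Rightarrow> (real \<Rightarrow> real) \<Rightarrow> real \<Rightarrow> real \<Rightarrow> ereal" where
  "mcvittie_density M \<Lambda> a t r =
     (if hubble_exists a t
      then ereal ((3 * ((hubble a t)\<^sup>2 + curv / (a t)\<^sup>2) - \<Lambda>) / (8 * pi))
      else \<infinity>)"

definition mcvittie_pressure ::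
    "real \<Rightarrow> real \<Rightarrow> (real \<Rightarrow> real) \<Rightarrow> real \<Rightarrow> real \<Rightarrow> ereal" where
  "mcvittie_pressure M \<Lambda> a t r =
     (if hubble_exists a t \<and> hubble a field_differentiable at t \<and>
         0 < kappa M a t r \<and>
         set_integrable lborel {r<..} (sigma_integrand M a t) \<and>
         sigma_over_H M a t r \<noteq> 0
      then ereal ((- 2 * (1 / sigma_over_H M a t r) * (deriv (hubble a) t - curv / (a t)\<^sup>2)
                   - 3 * ((hubble a t)\<^sup>2 + curv / (a t)\<^sup>2) + \<Lambda>) / (8 * pi))
      else \<infinity>)"

text \<open>
  Finiteness at \<open>(t, r)\<close> with \<open>r \<ge> r\<^sub>1(t)\<close>: on the boundary \<open>r = r\<^sub>1(t)\<close> the value is the one-sided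
  limit at fixed \<open>t\<close>, which has to exist and be finite.
\<close>

definition finite_at :: "real \<Rightarrow> (real \<Rightarrow> real) \<Rightarrow> (real \<Rightarrow> real \<Rightarrow> ereal) \<Rightarrow> real \<Rightarrow> real \<Rightarrow> bool" where
  "finite_at M a f t r \<longleftrightarrow>
     (if r = r1 M a t
      then \<exists>L. \<bar>L\<bar> \<noteq> \<infinity> \<and> (f t \<longlongrightarrow> L) (at_right r)
      else \<bar>f t r\<bar> \<noteq> \<infinity>)"

end

theory Submission
  imports Defs
begin

text \<open>
  Both expressions for the pressure involve the same \<open>H\<close>, \<open>H'\<close> and \<open>a\<close>, so only the factor
  \<open>H/\<sigma>\<close> can diverge. For \<open>r > r\<^sub>1\<close> the integrand \<open>x \<kappa>\<^sup>-\<^sup>3\<^sup>/\<^sup>2\<close> is positive and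
  decays like \<open>x\<^sup>-\<^sup>2\<close>, whence \<open>0 < \<sigma>/H < \<infinity>\<close>. At \<open>r\<^sub>1\<close>, l'Hopital's rule for
  the quotient of \<open>\<integral>\<^sub>r\<^sup>\<infinity> x \<kappa>\<^sup>-\<^sup>3\<^sup>/\<^sup>2 dx\<close> by \<open>\<kappa>\<^sup>-\<^sup>1\<^sup>/\<^sup>2\<close> shows
  \<open>\<sigma>/H \<rightarrow> 2 r\<^sub>1 / (a\<^sup>2 \<kappa>'(r\<^sub>1))\<close>, which is positive because \<open>\<kappa>'\<close> is.
\<close>

section \<open>Monotonicity of \<open>kappa\<close>, its zero \<open>r1\<close>, and a lower
  bound\<close>

lemma kappa_has_real_derivative:
  assumes "0 < r"
  shows "(kappa M a t has_real_derivative (2 * M / r\<^sup>2 + 2 * r / (a t)\<^sup>2)) (at r)"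
proof -
  have "((\<lambda>r. 1 - 2 * M / r + inverse ((a t)\<^sup>2) * r\<^sup>2) has_real_derivative
      (2 * M / r\<^sup>2 + inverse ((a t)\<^sup>2) * (2 * r))) (at r)"
    using assms by (auto intro!: derivative_eq_intros simp: power2_eq_square)
  then show ?thesis
    by (simp add: kappa_def[abs_def] divide_inverse mult.commute)
qed

lemma kappa_mono:
  assumes "0 < M" "0 < r" "r < s"
  shows "kappa M a t r < kappa M a t s"
proof -
  have "2 * M / s < 2 * M / r" "r\<^sup>2 / (a t)\<^sup>2 \<le> s\<^sup>2 / (a t)\<^sup>2"
    using assms by (auto intro!: divide_strict_left_mono divide_right_mono power_mono)
  then show ?thesis
    by (simp add: kappa_def)
qed

text \<open>Existence comes from the intermediate value theorem, uniqueness from strict monotonicity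
  of \<open>kappa\<close>; the two together justify the \<open>THE\<close> in
  \<open>r1\<close>.\<close>

lemma r1_zero:
  assumes "0 < M"
  shows "0 < r1 M a t" "kappa M a t (r1 M a t) = 0"
proof -
  \<comment> \<open>The cubic \<open>r * kappa\<close>, which unlike \<open>kappa\<close> is
    continuous at 0. The bracket is \<open>[0, 2 * M]\<close>: there
    \<open>p 0 = - 2 * M < 0\<close>, while \<open>p (2 * M)\<close> is a nonnegative multiple of
    \<open>(2 * M) ^ 3\<close>.\<close>
  define p where "p r = r - 2 * M + inverse ((a t)\<^sup>2) * r ^ 3" for r
  have "\<exists>r\<ge>0. r \<le> 2 * M \<and> p r = 0"
    using assms by (intro IVT') (auto simp: p_def intro!: continuous_intros)
  then obtain r where r: "0 \<le> r" "p r = 0"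
    by blast
  then have "0 < r"
    using assms by (cases "r = 0") (auto simp: p_def)
  moreover have "kappa M a t r = p r / r"
    using \<open>0 < r\<close> by (simp add: kappa_def p_def divide_inverse algebra_simps power2_eq_square power3_eq_cube)
  ultimately have "0 < r \<and> kappa M a t r = 0"
    using r by simp
  moreover have "s = r" if "0 < s \<and> kappa M a t s = 0" for s
    using that calculation kappa_mono[OF assms, of r s a t] kappa_mono[OF assms, of s r a t]
    by (cases r s rule: linorder_cases) auto
  ultimately have "0 < r1 M a t \<and> kappa M a t (r1 M a t) = 0"
    unfolding r1_def by (rule theI)
  then show "0 < r1 M a t" "kappa M a t (r1 M a t) = 0"
    by auto
qed

lemma kappa_pos:
  assumes "0 < M" "r1 M a t < r"
  shows "0 < kappa M a t r"
  using kappa_mono[OF assms(1) r1_zero(1) assms(2)] r1_zero(2) assms(1) by metis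

text \<open>With s = \<open>r1 M a t\<close>, subtracting \<open>kappa\<close> at s, which is 0,
  leaves 2M(1/s - 1/x) + (x^2 - s^2)/a^2. The first term is nonnegative, and s^2 <= s^2 x^2/r^2
  because x >= r. This quadratic growth, uniform on [r, infinity), yields the decay of the
  integrand.\<close>

lemma kappa_ge_square:
  assumes "0 < M" "r1 M a t < r" "r \<le> x"
  shows "(1 - (r1 M a t)\<^sup>2 / r\<^sup>2) / (a t)\<^sup>2 * x\<^sup>2 \<le> kappa M a t x"
proof -
  define s where "s = r1 M a t"
  have s: "0 < s" "1 - 2 * M / s + s\<^sup>2 / (a t)\<^sup>2 = 0" "s < r"
    using r1_zero[OF assms(1)] assms(2) by (auto simp: s_def kappa_def)
  have "r\<^sup>2 \<le> x\<^sup>2"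
    using assms s by (intro power_mono) auto
  then have "s\<^sup>2 * 1 \<le> s\<^sup>2 * (x\<^sup>2 / r\<^sup>2)"
    using s by (intro mult_left_mono) auto
  then have "(1 - s\<^sup>2 / r\<^sup>2) * x\<^sup>2 \<le> x\<^sup>2 - s\<^sup>2"
    by (simp add: algebra_simps)
  then have "(1 - s\<^sup>2 / r\<^sup>2) * x\<^sup>2 / (a t)\<^sup>2 \<le> (x\<^sup>2 - s\<^sup>2) / (a t)\<^sup>2"
    by (intro divide_right_mono) auto
  moreover have "2 * M / x \<le> 2 * M / s"
    using assms s by (intro divide_left_mono) auto
  ultimately have "(1 - s\<^sup>2 / r\<^sup>2) * x\<^sup>2 / (a t)\<^sup>2 \<le> kappa M a t x"
    using s(2) unfolding kappa_def diff_divide_distrib by linarith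
  then show ?thesis
    by (simp add: s_def)
qed

section \<open>Integrability of the integrand beyond \<open>r1\<close>\<close>

lemma sigma_integrand_continuous_on:
  assumes "0 < M" "S \<subseteq> {r1 M a t<..}"
  shows "continuous_on S (sigma_integrand M a t)"
proof -
  have "continuous_on S (kappa M a t)"
    using assms r1_zero(1)[OF assms(1), of a t]
    by (intro DERIV_continuous_on[OF has_field_derivative_at_within[OF kappa_has_real_derivative]])
       (fastforce)
  moreover have "kappa M a t x \<noteq> 0" if "x \<in> S" for x
    using kappa_pos[OF assms(1), of a t x] that assms(2) by auto
  ultimately show ?thesis
    unfolding sigma_integrand_def[abs_def] by (intro continuous_intros) auto
qed

lemma sigma_integrand_pos:
  assumes "0 < M" "r1 M a t < x"
  shows "0 < sigma_integrand M a t x"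
  using kappa_pos[OF assms] r1_zero(1)[OF assms(1), of a t] assms(2)
  by (simp add: sigma_integrand_def)

text \<open>The antiderivative -1/x has finite limits at both ends, so the fundamental theorem for
  nonnegative integrands gives integrability. This is the dominating function for
  \<open>sigma_integrand\<close>.\<close>

lemma set_integrable_inverse_square:
  fixes r :: real
  assumes "0 < r"
  shows "set_integrable lborel {r<..} (\<lambda>x. inverse (x\<^sup>2))"
proof -
  have "set_integrable lborel (einterval (ereal r) \<infinity>) (\<lambda>x. inverse (x\<^sup>2))"
  proof (rule interval_integral_FTC_nonneg(1))
    show "ereal r < \<infinity>" by simp
    show "DERIV (\<lambda>x. - inverse x) x :> inverse (x\<^sup>2)" if "ereal r < ereal x" "ereal x < \<infinity>" for x
      using that assms by (auto intro!: derivative_eq_intros simp: power2_eq_square)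
    show "isCont (\<lambda>x. inverse (x\<^sup>2)) x" if "ereal r < ereal x" "ereal x < \<infinity>" for x
      using that assms by (auto intro!: continuous_intros)
    show "AE x in lborel. ereal r < ereal x \<longrightarrow> ereal x < \<infinity> \<longrightarrow> 0 \<le> inverse (x\<^sup>2)"
      by simp
    have "((\<lambda>x. - inverse x) \<longlongrightarrow> - inverse r) (at_right r)"
      using assms by (auto intro!: tendsto_intros)
    then show "(((\<lambda>x. - inverse x) \<circ> real_of_ereal) \<longlongrightarrow> - inverse r) (at_right (ereal r))"
      by (simp add: ereal_tendsto_simps)
    have "((\<lambda>x::real. - inverse x) \<longlongrightarrow> - 0) at_top"
      by (intro tendsto_minus tendsto_inverse_0_at_top filterlim_ident)
    then show "(((\<lambda>x. - inverse x) \<circ> real_of_ereal) \<longlongrightarrow> 0) (at_left \<infinity>)"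
      by (simp add: ereal_tendsto_simps)
  qed
  then show ?thesis
    by simp
qed

text \<open>Domination: \<open>kappa_ge_square\<close> gives kappa >= c x^2 with c > 0, and the
  negative exponent reverses this into x kappa^(-3/2) <= c^(-3/2) x^(-2).\<close>

lemma sigma_integrand_integrable:
  assumes "0 < M" "a t \<noteq> 0" "r1 M a t < r"
  shows "set_integrable lborel {r<..} (sigma_integrand M a t)"
proof -
  define c where "c = (1 - (r1 M a t)\<^sup>2 / r\<^sup>2) / (a t)\<^sup>2"
  have r: "0 < r1 M a t" "0 < r"
    using r1_zero(1)[OF assms(1), of a t] assms(3) by auto
  have "(r1 M a t)\<^sup>2 < r\<^sup>2"
    using assms r by (intro power_strict_mono) auto
  then have c: "0 < c"
    using assms r by (simp add: c_def)
  have bound: "sigma_integrand M a t x \<le> c powr (-3/2) * inverse (x\<^sup>2)" if "r < x" for x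
  proof -
    have "kappa M a t x powr (-3/2) \<le> (c * x\<^sup>2) powr (-3/2)"
      using kappa_ge_square[OF assms(1,3), of x] that c r
      by (intro powr_mono2') (auto simp flip: c_def)
    also have "\<dots> = c powr (-3/2) * (x\<^sup>2) powr (-3/2)"
      using c by (simp add: powr_mult)
    also have "(x\<^sup>2) powr (-3/2) = x powr (-3)"
      using that r by (simp add: powr_powr flip: powr_numeral)
    also have "\<dots> = inverse (x ^ 3)"
      using that r by (simp add: powr_minus)
    finally have "x * kappa M a t x powr (-3/2) \<le> x * (c powr (-3/2) * inverse (x ^ 3))"
      using that r by (intro mult_left_mono) auto
    also have "\<dots> = c powr (-3/2) * inverse (x\<^sup>2)"
      using that r by (simp add: field_simps power2_eq_square power3_eq_cube)
    finally show ?thesis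
      by (simp add: sigma_integrand_def)
  qed
  show ?thesis
  proof (rule set_integrable_bound)
    show "set_integrable lborel {r<..} (\<lambda>x. c powr (-3/2) * inverse (x\<^sup>2))"
      using set_integrable_inverse_square[OF r(2)] by (rule set_integrable_mult_right)
    show "set_borel_measurable lborel {r<..} (sigma_integrand M a t)"
      unfolding set_borel_measurable_def
      using borel_measurable_continuous_on_indicator[OF _ sigma_integrand_continuous_on[OF assms(1)],
          of "{r<..}" a t] assms(3) by auto
    show "AE x in lborel. x \<in> {r<..} \<longrightarrow>
        norm (sigma_integrand M a t x) \<le> norm (c powr (-3/2) * inverse (x\<^sup>2))"
    proof (intro AE_I2 impI)
      fix x assume "x \<in> {r<..}"
      then show "norm (sigma_integrand M a t x) \<le> norm (c powr (-3/2) * inverse (x\<^sup>2))"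
        using bound[of x] sigma_integrand_pos[OF assms(1), of a t x] assms(3) by simp
    qed
  qed
qed

section \<open>The tail integral, and positivity and boundary limit of
  \<open>sigma_over_H\<close>\<close>

lemma sigma_integral_has_real_derivative:
  assumes "0 < M" "a t \<noteq> 0" "r1 M a t < r"
  shows "((\<lambda>u. LBINT x:{u<..}. sigma_integrand M a t x) has_real_derivative
          - sigma_integrand M a t r) (at r)"
proof -
  \<comment> \<open>The base point \<open>c\<close> lies strictly between \<open>r1\<close> and
    \<open>r\<close>, so the integrand is continuous from \<open>c\<close> on; \<open>d\<close>
    makes \<open>r\<close> an interior point of \<open>{c..d}\<close>.\<close>
  define c d where "c = (r1 M a t + r) / 2" and "d = r + 1"
  let ?f = "sigma_integrand M a t"
  have cd: "r1 M a t < c" "c < r" "r < d"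
    using assms by (auto simp: c_def d_def)
  have cont: "continuous_on {c..u} ?f" for u
    using cd by (intro sigma_integrand_continuous_on[OF assms(1)]) auto
  \<comment> \<open>The moving lower limit is traded for a moving upper one: the gauge integral over
    \<open>{c..}\<close> is split at \<open>u\<close>, and its tail agrees with the Lebesgue
    integral.\<close>
  have eq: "integral {c..} ?f - integral {c..u} ?f = (LBINT x:{u<..}. ?f x)" if "c \<le> u" for u
  proof -
    have "set_integrable lborel {u<..} ?f"
      using that cd by (intro sigma_integrand_integrable assms) auto
    note u = set_borel_integral_eq_integral[OF this]
    have "{c..u} \<inter> {u<..} = {}"
      by auto
    then have "integral ({c..u} \<union> {u<..}) ?f = integral {c..u} ?f + integral {u<..} ?f"
      using cont u by (intro integral_Un integrable_continuous_real) auto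
    moreover have "{c..u} \<union> {u<..} = {c..}"
      using that by auto
    ultimately show ?thesis
      using u by simp
  qed
  have "((\<lambda>u. integral {c..u} ?f) has_real_derivative ?f r) (at r within {c..d})"
    using cont cd by (intro integral_has_real_derivative) auto
  then have "((\<lambda>u. integral {c..u} ?f) has_real_derivative ?f r) (at r)"
    using cd by (simp add: at_within_Icc_at)
  then have "((\<lambda>u. integral {c..} ?f - integral {c..u} ?f) has_real_derivative - ?f r) (at r)"
    by (auto intro!: derivative_eq_intros)
  \<comment> \<open>The splitting holds only for u >= c, so the derivative is transferred on the
    open neighbourhood \<open>{c<..}\<close> of \<open>r\<close>.\<close>
  then show ?thesis
    by (rule has_field_derivative_transform_within_open[where S = "{c<..}"]) (use cd eq in auto)
qed

text \<open>The tail integral has negative derivative, so its value at \<open>r\<close> strictly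
  exceeds its nonnegative value at \<open>r + 1\<close>; the prefactor is positive too.\<close>

lemma sigma_over_H_pos:
  assumes "0 < M" "a t \<noteq> 0" "r1 M a t < r"
  shows "0 < sigma_over_H M a t r"
proof -
  let ?F = "\<lambda>u. LBINT x:{u<..}. sigma_integrand M a t x"
  have "0 \<le> ?F (r + 1)"
    unfolding set_lebesgue_integral_def
    using sigma_integrand_pos[OF assms(1), of a t] assms(3)
    by (intro Bochner_Integration.integral_nonneg) (force simp: indicator_def less_imp_le)
  also have "\<dots> < ?F r"
  proof (rule DERIV_neg_imp_decreasing[where f = ?F])
    show "\<exists>y. DERIV ?F x :> y \<and> y < 0" if "r \<le> x" "x \<le> r + 1" for x
    proof (intro exI conjI)
      show "(?F has_real_derivative - sigma_integrand M a t x) (at x)"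
        by (rule sigma_integral_has_real_derivative) (use assms that in simp_all)
      show "- sigma_integrand M a t x < 0"
        using sigma_integrand_pos[of M a t x] assms that by simp
    qed
  qed simp
  finally show ?thesis
    using kappa_pos[OF assms(1,3)] assms(2) by (simp add: sigma_over_H_def)
qed

text \<open>The limit must be nonzero as well as finite, since the pressure contains the reciprocal
  of \<open>sigma_over_H\<close>.\<close>

lemma sigma_over_H_limit:
  assumes "0 < M" "a t \<noteq> 0"
  shows "\<exists>L>0. (sigma_over_H M a t \<longlongrightarrow> L) (at_right (r1 M a t))"
proof -
  define s where "s = r1 M a t"
  define k' where "k' r = 2 * M / r\<^sup>2 + 2 * r / (a t)\<^sup>2" for r
  let ?k = "kappa M a t" and ?f = "sigma_integrand M a t"
  let ?F = "\<lambda>u. LBINT x:{u<..}. ?f x"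
  have s: "0 < s" "?k s = 0"
    using r1_zero[OF assms(1), of a t] by (auto simp: s_def)
  have k'_pos: "0 < k' r" if "0 < r" for r
    using that assms by (auto simp: k'_def intro!: add_pos_nonneg)
  have gt: "eventually (\<lambda>r. s < r) (at_right s)"
    by (rule eventually_at_right_less)
  have k_pos: "0 < ?k r" if "s < r" for r
    using kappa_pos[OF assms(1)] that by (simp add: s_def)
  have dk: "(?k has_real_derivative k' r) (at r)" if "0 < r" for r
    using kappa_has_real_derivative[OF that] by (simp add: k'_def)
  have "((\<lambda>r. ?F r / ?k r powr (-1/2)) \<longlongrightarrow> 2 * s / k' s) (at_right s)"
  proof (rule lhopital_right_at_top)
    have "(?k \<longlongrightarrow> 0) (at_right s)"
      using DERIV_isCont[OF dk[OF s(1)]] s(2) by (auto simp: isCont_def filterlim_at_split)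
    then have "((\<lambda>r. sqrt (?k r)) \<longlongrightarrow> 0) (at_right s)"
      using tendsto_real_sqrt by fastforce
    moreover have "eventually (\<lambda>r. 0 < sqrt (?k r)) (at_right s)"
      using gt by eventually_elim (simp add: k_pos)
    ultimately have "LIM r at_right s. inverse (sqrt (?k r)) :> at_top"
      by (rule filterlim_inverse_at_top)
    moreover have "eventually (\<lambda>r. inverse (sqrt (?k r)) = ?k r powr (-1/2)) (at_right s)"
      using gt
    proof eventually_elim
      case (elim r)
      then show ?case using k_pos[of r] by (simp add: powr_minus powr_half_sqrt)
    qed
    ultimately show "LIM r at_right s. ?k r powr (-1/2) :> at_top"
      by (rule filterlim_mono_eventually[OF _ order_refl order_refl])
    show "eventually (\<lambda>r. -1/2 * ?k r powr (-3/2) * k' r \<noteq> 0) (at_right s)"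
      using gt
    proof eventually_elim
      case (elim r)
      then show ?case using k_pos[of r] k'_pos[of r] s by auto
    qed
    show "eventually (\<lambda>r. (?F has_real_derivative - ?f r) (at r)) (at_right s)"
      using gt by eventually_elim
        (rule sigma_integral_has_real_derivative, use assms in \<open>simp_all add: s_def\<close>)
    show "eventually (\<lambda>r. ((\<lambda>r. ?k r powr (-1/2)) has_real_derivative
        -1/2 * ?k r powr (-3/2) * k' r) (at r)) (at_right s)"
      using gt
    proof eventually_elim
      case (elim r)
      then show ?case
        using DERIV_fun_powr[OF dk k_pos, of r "-1/2"] s by simp
    qed
    \<comment> \<open>Since \<open>?f r\<close> is r kappa^(-3/2), the powers of kappa cancel in the
      quotient of the derivatives and leave this function, which is continuous at
      \<open>s\<close>.\<close>
    have "((\<lambda>r. 2 * r / k' r) \<longlongrightarrow> 2 * s / k' s) (at_right s)"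
      unfolding k'_def
      by (intro tendsto_intros) (use s assms(2) k'_pos[OF s(1)] in \<open>simp_all add: k'_def\<close>)
    then show "((\<lambda>r. - ?f r / (-1/2 * ?k r powr (-3/2) * k' r)) \<longlongrightarrow> 2 * s / k' s) (at_right s)"
    proof (rule Lim_transform_eventually)
      show "eventually (\<lambda>r. 2 * r / k' r = - ?f r / (-1/2 * ?k r powr (-3/2) * k' r)) (at_right s)"
        using gt
      proof eventually_elim
        case (elim r)
        then show ?case
          using k_pos[of r] k'_pos[of r] s by (simp add: sigma_integrand_def)
      qed
    qed
  qed
  then have "((\<lambda>r. ?F r / ?k r powr (-1/2) / (a t)\<^sup>2) \<longlongrightarrow> 2 * s / k' s / (a t)\<^sup>2) (at_right s)"
    by (rule tendsto_divide) (use assms in auto)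
  then have "(sigma_over_H M a t \<longlongrightarrow> 2 * s / k' s / (a t)\<^sup>2) (at_right s)"
  proof (rule Lim_transform_eventually)
    show "eventually (\<lambda>r. ?F r / ?k r powr (-1/2) / (a t)\<^sup>2 = sigma_over_H M a t r) (at_right s)"
      using gt
    proof eventually_elim
      case (elim r)
      then have "?k r powr (-1/2) = inverse (sqrt (?k r))"
        using k_pos[of r] by (simp add: powr_minus powr_half_sqrt)
      then show ?case
        unfolding sigma_over_H_def by (simp add: inverse_eq_divide mult.commute)
    qed
  qed
  moreover have "0 < 2 * s / k' s / (a t)\<^sup>2"
    using s k'_pos[OF s(1)] assms by simp
  ultimately show ?thesis
    unfolding s_def by blast
qed

section \<open>Finiteness of density and pressure\<close>

theorem proposition4p2:
  fixes M \<Lambda> :: real and a :: "real \<Rightarrow> real" and T I :: "real set"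
  assumes "M > 0"
    and "open T" and "is_interval T"
    and "C2_on a T" and "\<forall>t\<in>T. a t > 0"
    and "maximal_flrw_interval \<Lambda> a T I"
  shows "\<forall>t\<in>I. \<forall>r\<ge>r1 M a t.
           finite_at M a (mcvittie_density M \<Lambda> a) t r \<and>
           finite_at M a (mcvittie_pressure M \<Lambda> a) t r"
proof (intro ballI allI impI)
  fix t r
  assume t: "t \<in> I" and r: "r1 M a t \<le> r"
  \<comment> \<open>A finite FLRW pressure rules out the default value, so H and H' exist at
    \<open>t\<close>.\<close>
  have "\<bar>flrw_pressure \<Lambda> a t\<bar> \<noteq> \<infinity>"
    using assms(6) t by (auto simp: maximal_flrw_interval_def flrw_finite_on_def)
  then have H: "hubble_exists a t" "hubble a field_differentiable at t"
    by (auto simp: flrw_pressure_def split: if_splits)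
  have a: "a t \<noteq> 0"
    using H(1) by (simp add: hubble_exists_def)
  \<comment> \<open>The pressure at fixed \<open>t\<close> as a function of q = sigma/H; it is
    continuous for q different from 0, so limits pass through it.\<close>
  define p where "p q = (- 2 * (1 / q) * (deriv (hubble a) t - curv / (a t)\<^sup>2)
                   - 3 * ((hubble a t)\<^sup>2 + curv / (a t)\<^sup>2) + \<Lambda>) / (8 * pi)" for q
  have P: "mcvittie_pressure M \<Lambda> a t u = ereal (p (sigma_over_H M a t u))" if "r1 M a t < u" for u
    using H kappa_pos[of M a t u] sigma_integrand_integrable[of M a t u]
      sigma_over_H_pos[of M a t u] assms(1) a that
    by (simp add: mcvittie_pressure_def p_def)
  obtain L where L: "0 < L" "(sigma_over_H M a t \<longlongrightarrow> L) (at_right (r1 M a t))"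
    using sigma_over_H_limit[of M a t] assms(1) a by blast
  have "((\<lambda>u. p (sigma_over_H M a t u)) \<longlongrightarrow> p L) (at_right (r1 M a t))"
    unfolding p_def using L by (intro tendsto_intros) auto
  then have "((\<lambda>u. ereal (p (sigma_over_H M a t u))) \<longlongrightarrow> ereal (p L)) (at_right (r1 M a t))"
    by (rule tendsto_ereal)
  \<comment> \<open>Agreement to the right of \<open>r1\<close> suffices. At \<open>r1\<close>
    itself \<open>kappa\<close> vanishes and \<open>mcvittie_pressure\<close> takes its default
    value, so only the limit is meaningful there.\<close>
  then have "(mcvittie_pressure M \<Lambda> a t \<longlongrightarrow> ereal (p L)) (at_right (r1 M a t))"
    by (rule Lim_transform_eventually)
       (use eventually_at_right_less[of "r1 M a t"] in \<open>eventually_elim, simp add: P\<close>)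
  then have "finite_at M a (mcvittie_pressure M \<Lambda> a) t r"
    using r P[of r] by (auto simp: finite_at_def intro!: exI[of _ "ereal (p L)"])
  \<comment> \<open>The density is constant in the radius, so the same number serves as value and as
    limit.\<close>
  moreover obtain d where "mcvittie_density M \<Lambda> a t = (\<lambda>_. ereal d)"
    using H(1) by (simp add: mcvittie_density_def[abs_def])
  then have "finite_at M a (mcvittie_density M \<Lambda> a) t r"
    by (auto simp: finite_at_def intro!: exI[of _ "ereal d"])
  ultimately show "finite_at M a (mcvittie_density M \<Lambda> a) t r \<and>
      finite_at M a (mcvittie_pressure M \<Lambda> a) t r"
    by blast
qed

end
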